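(* Suppose $D$ is uniform. If $\alpha\in C_{n,D}$ is irrational, then $\alpha$ is not translation equivalent to any rational number.
   Context: Let $n\ge 3$ be an integer and let $D=\{d_1<d_2<\cdots<d_m\}\subseteq\{0,1,\ldots,n-1\}$ be a digit set with $2\le m<n$ and $d_1=0$. $D$ is uniform if $d_{k+1}-d_k$, $k=1,\ldots,m-1$, is constant and $\ge2$. Put $C=C_{n,D}:=\{\sum_{k=1}^\infty x_k n^{-k} : x_k\in D \text{ for all } k\ge1\}$. For $t\in\mathbb{R}$, if $C\cap(C+t)\neq\varnothing$ let $C(t):=(C\cap(C+t))-\inf(C\cap(C+t))$, otherwise $C(t):=\varnothing$. Real numbers $s,t$ are translation equivalent if $C(s)=C(t)$. *)

theory Defs
  imports Complex_Main
begin

definition digit_set :: "nat \<Rightarrow> nat set \<Rightarrow> bool" where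
  "digit_set n D \<longleftrightarrow>
     n \<ge> 3 \<and> D \<subseteq> {0..n - 1} \<and> 2 \<le> card D \<and> card D < n \<and> Min D = 0"

(* The library list is indexed from 0: its entry k is the digit d_(k+1). *)
definition uniform_digits :: "nat set \<Rightarrow> bool" where
  "uniform_digits D \<longleftrightarrow>
     (\<exists>c\<ge>2. \<forall>k. Suc k < card D \<longrightarrow>
        int (sorted_list_of_set D ! Suc k) - int (sorted_list_of_set D ! k) = c)"

(* The series starts at k = 1, hence the shift by Suc. *)
definition cantor_set :: "nat \<Rightarrow> nat set \<Rightarrow> real set" where
  "cantor_set n D =
     {(\<Sum>k. real (x (Suc k)) / real n ^ Suc k) | x :: nat \<Rightarrow> nat. \<forall>k\<ge>1. x k \<in> D}"

definition translate_inter :: "nat \<Rightarrow> nat set \<Rightarrow> real \<Rightarrow> real set" where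
  "translate_inter n D t = cantor_set n D \<inter> (\<lambda>x. x + t) ` cantor_set n D"

definition normalized_inter :: "nat \<Rightarrow> nat set \<Rightarrow> real \<Rightarrow> real set" where
  "normalized_inter n D t =
     (if translate_inter n D t \<noteq> {}
      then (\<lambda>x. x - Inf (translate_inter n D t)) ` translate_inter n D t
      else {})"

definition translation_equivalent :: "nat \<Rightarrow> nat set \<Rightarrow> real \<Rightarrow> real \<Rightarrow> bool" where
  "translation_equivalent n D s t \<longleftrightarrow> normalized_inter n D s = normalized_inter n D t"

end

(*
  Write T(t) = C \<inter> (C + t) and L = max C. If \<alpha> \<in> C, then \<alpha> = min T(\<alpha>), and since the digits
  are symmetric (L - C = C) also L = max T(\<alpha>); so the normalised set of \<alpha> has supremum L - \<alpha>, which
  is irrational.  For rational q, the symmetry x \<mapsto> L + q - x of T(q) reduces the rationality of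
  sup T(q) - inf T(q) to that of sup T(q).  Self-similarity gives
  sup T(t) = (d + sup T(n t + d' - d)) / n for suitable digits d, d'; starting at t = q, the
  translations n t + d' - d stay among the finitely many fractions in [-1, 1] with the denominator
  of q, so one of them recurs, and then the supremum solves a linear equation over the rationals.
*)
theory Submission
  imports Defs
begin

section \<open>Expansions and self-similarity of the Cantor set\<close>

locale cantor_digits =
  fixes n :: nat and D :: "nat set"
  assumes digit_set: "digit_set n D"
begin

lemma n_ge: "n \<ge> 3"
  using digit_set by (simp add: digit_set_def)

lemma finite_digits: "finite D"
  using digit_set by (auto simp: digit_set_def intro: finite_subset)

lemma digits_nonempty: "D \<noteq> {}"
  using digit_set by (auto simp: digit_set_def)

lemma zero_digit: "0 \<in> D"
  using Min_in[OF finite_digits digits_nonempty] digit_set by (simp add: digit_set_def)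

lemma digit_le: "d \<in> D \<Longrightarrow> d \<le> n - 1"
  using digit_set by (auto simp: digit_set_def)

lemma constant_digit_sums: "(\<lambda>k. c / real n ^ Suc k) sums (c / (real n - 1))"
proof -
  have "(\<lambda>k. c / real n * (1 / real n) ^ k) sums (c / real n * (1 / (1 - 1 / real n)))"
    by (intro sums_mult geometric_sums) (use n_ge in auto)
  moreover have "c / real n * (1 / (1 - 1 / real n)) = c / (real n - 1)"
    using n_ge by (simp add: divide_simps)
  moreover have "c / real n * (1 / real n) ^ k = c / real n ^ Suc k" for k
    by (simp add: power_divide)
  ultimately show ?thesis
    by (simp only:)
qed

lemma expansion_summable:
  fixes x :: "nat \<Rightarrow> nat"
  assumes "\<And>k. x k \<in> D"
  shows "summable (\<lambda>k. real (x k) / real n ^ Suc k)"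
proof (rule summable_comparison_test'[OF sums_summable[OF constant_digit_sums[of "real (n - 1)"]]])
  show "norm (real (x k) / real n ^ Suc k) \<le> real (n - 1) / real n ^ Suc k" for k
    using digit_le[OF assms[of k]] by (simp add: divide_right_mono)
qed

text \<open>Reindexes the digit sequences from 0, so that every term constrains its digit and
  sequence operations need no shift.\<close>

lemma mem_cantor_set_iff:
  "r \<in> cantor_set n D \<longleftrightarrow>
     (\<exists>x :: nat \<Rightarrow> nat. (\<forall>k. x k \<in> D) \<and> r = (\<Sum>k. real (x k) / real n ^ Suc k))"
proof
  assume "r \<in> cantor_set n D"
  then obtain x where x: "\<forall>k\<ge>1. x k \<in> D"
    and r: "r = (\<Sum>k. real (x (Suc k)) / real n ^ Suc k)"
    by (auto simp: cantor_set_def)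
  then show "\<exists>x :: nat \<Rightarrow> nat. (\<forall>k. x k \<in> D) \<and> r = (\<Sum>k. real (x k) / real n ^ Suc k)"
    by (intro exI[of _ "\<lambda>k. x (Suc k)"]) auto
next
  assume "\<exists>x :: nat \<Rightarrow> nat. (\<forall>k. x k \<in> D) \<and> r = (\<Sum>k. real (x k) / real n ^ Suc k)"
  then obtain x :: "nat \<Rightarrow> nat"
    where "\<forall>k. x k \<in> D" "r = (\<Sum>k. real (x k) / real n ^ Suc k)"
    by blast
  then show "r \<in> cantor_set n D"
    unfolding cantor_set_def by (intro CollectI exI[of _ "\<lambda>k. x (k - 1)"]) auto
qed

lemma zero_in_cantor_set: "0 \<in> cantor_set n D"
  unfolding mem_cantor_set_iff by (rule exI[of _ "\<lambda>_. 0"]) (simp add: zero_digit)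

lemma cantor_set_nonneg: "r \<in> cantor_set n D \<Longrightarrow> 0 \<le> r"
  by (auto simp: mem_cantor_set_iff simp del: power_Suc intro!: suminf_nonneg expansion_summable)

lemma cantor_set_le_Max:
  assumes "r \<in> cantor_set n D"
  shows "r \<le> real (Max D) / (real n - 1)"
proof -
  obtain x :: "nat \<Rightarrow> nat" where x: "\<And>k. x k \<in> D"
    and r: "r = (\<Sum>k. real (x k) / real n ^ Suc k)"
    using assms by (auto simp: mem_cantor_set_iff)
  have "r \<le> (\<Sum>k. real (Max D) / real n ^ Suc k)"
    unfolding r
  proof (rule suminf_le)
    show "real (x k) / real n ^ Suc k \<le> real (Max D) / real n ^ Suc k" for k
      using Max_ge[OF finite_digits x[of k]] by (simp add: divide_right_mono)
  qed (rule expansion_summable[OF x], rule sums_summable[OF constant_digit_sums])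
  then show ?thesis
    using sums_unique[OF constant_digit_sums] by simp
qed

lemma cantor_set_le_1:
  assumes "r \<in> cantor_set n D"
  shows "r \<le> 1"
proof -
  have "Max D \<le> n - 1"
    using digit_le Max_in[OF finite_digits digits_nonempty] by blast
  then have "real (Max D) / (real n - 1) \<le> 1"
    using n_ge by (simp add: field_simps)
  with cantor_set_le_Max[OF assms] show ?thesis
    by linarith
qed

text \<open>Self-similarity: multiplying by \<open>n\<close> and subtracting the leading digit drops
  that digit from an expansion; conversely, any digit can be prepended.\<close>

lemma cantor_set_unfold:
  "r \<in> cantor_set n D \<longleftrightarrow> (\<exists>d\<in>D. real n * r - real d \<in> cantor_set n D)"
proof
  assume "r \<in> cantor_set n D"
  then obtain x :: "nat \<Rightarrow> nat" where x: "\<And>k. x k \<in> D"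
    and r: "r = (\<Sum>k. real (x k) / real n ^ Suc k)"
    by (auto simp: mem_cantor_set_iff)
  have sm: "summable (\<lambda>k. real (x (Suc k)) / real n ^ Suc k)"
    by (intro expansion_summable x)
  have "r = real (x 0) / real n + (\<Sum>k. real (x (Suc k)) / real n ^ Suc k / real n)"
    unfolding r
    by (subst suminf_split_head[OF expansion_summable[OF x], THEN eq_diff_eq[THEN iffD1], symmetric])
       (simp add: field_simps)
  also have "\<dots> = real (x 0) / real n + (\<Sum>k. real (x (Suc k)) / real n ^ Suc k) / real n"
    by (simp only: suminf_divide[OF sm])
  finally have "real n * r - real (x 0) = (\<Sum>k. real (x (Suc k)) / real n ^ Suc k)"
    using n_ge by (simp add: field_simps)
  then have "real n * r - real (x 0) \<in> cantor_set n D"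
    unfolding mem_cantor_set_iff using x by (intro exI[of _ "\<lambda>k. x (Suc k)"]) auto
  then show "\<exists>d\<in>D. real n * r - real d \<in> cantor_set n D"
    using x by blast
next
  assume "\<exists>d\<in>D. real n * r - real d \<in> cantor_set n D"
  then obtain d x where d: "d \<in> D" and x: "\<And>k. x k \<in> D"
    and r: "real n * r - real d = (\<Sum>k. real (x k) / real n ^ Suc k)"
    by (auto simp: mem_cantor_set_iff)
  \<comment> \<open>The sequence \<open>x\<close> with the digit \<open>d\<close> put in
    front.\<close>
  define y where "y = case_nat d x"
  have y: "y k \<in> D" for k
    using d x by (auto simp: y_def split: nat.split)
  have "(\<lambda>k. real (x k) / real n ^ Suc k / real n) sums ((real n * r - real d) / real n)"
    unfolding r by (intro sums_divide summable_sums expansion_summable x)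
  then have "(\<lambda>k. real (y (Suc k)) / real n ^ Suc (Suc k)) sums (r - real (y 0) / real n ^ Suc 0)"
    using n_ge by (simp add: y_def field_simps)
  then have "(\<lambda>k. real (y k) / real n ^ Suc k) sums r"
    by (subst (asm) sums_Suc_iff) simp
  then show "r \<in> cantor_set n D"
    unfolding mem_cantor_set_iff using y by (auto dest: sums_unique)
qed

section \<open>Intersections with a translate and their suprema\<close>

lemma mem_translate_inter:
  "x \<in> translate_inter n D t \<longleftrightarrow> x \<in> cantor_set n D \<and> x - t \<in> cantor_set n D"
  by (force simp: translate_inter_def image_iff)

text \<open>Let \<open>d\<close> and \<open>e\<close> be leading digits of \<open>x\<close> and
  \<open>x - t\<close>. Dropping both turns the difference \<open>t\<close> of the two points into
  \<open>(n * x - d) - (n * (x - t) - e) = n * t + e - d\<close>.\<close>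

lemma translate_inter_unfold:
  "x \<in> translate_inter n D t \<longleftrightarrow>
     (\<exists>d\<in>D. \<exists>e\<in>D. real n * x - real d \<in> translate_inter n D (real n * t + real e - real d))"
proof -
  have eq: "real n * x - real d - (real n * t + real e - real d) = real n * (x - t) - real e"
    for d e by (simp add: algebra_simps)
  show ?thesis
    unfolding mem_translate_inter eq
    by (subst cantor_set_unfold[of x], subst cantor_set_unfold[of "x - t"]) blast
qed

lemma bdd_above_translate_inter: "bdd_above (translate_inter n D t)"
  using cantor_set_le_1 by (auto simp: mem_translate_inter intro: bdd_aboveI[of _ 1])

lemma bdd_below_translate_inter: "bdd_below (translate_inter n D t)"
  using cantor_set_nonneg by (auto simp: mem_translate_inter intro: bdd_belowI[of _ 0])

text \<open>A translation with nonempty intersection is a difference of two points of [0, 1]. This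
  bound later makes the set of relevant translations finite.\<close>

lemma abs_translation_le_1:
  assumes "translate_inter n D t \<noteq> {}"
  shows "\<bar>t\<bar> \<le> 1"
proof -
  obtain x where x: "x \<in> cantor_set n D" "x - t \<in> cantor_set n D"
    using assms by (auto simp: mem_translate_inter)
  show ?thesis
    using cantor_set_nonneg[OF x(1)] cantor_set_nonneg[OF x(2)]
      cantor_set_le_1[OF x(1)] cantor_set_le_1[OF x(2)] by linarith
qed

text \<open>The digit pairs split the intersection into finitely many scaled copies of other
  intersections; its supremum is that of the copy reaching furthest.\<close>

lemma Sup_translate_inter_unfold:
  assumes "translate_inter n D t \<noteq> {}"
  obtains d e where "translate_inter n D (real n * t + real e - real d) \<noteq> {}"
    and "real n * Sup (translate_inter n D t) =
           real d + Sup (translate_inter n D (real n * t + real e - real d))"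
proof -
  let ?T = "\<lambda>p. translate_inter n D (real n * t + real (snd p) - real (fst p))"
  \<comment> \<open>\<open>v p / n\<close> is the supremum of the copy belonging to the pair
    \<open>p\<close>. The set \<open>P\<close> excludes empty copies, for which \<open>Sup\<close>
    carries no information.\<close>
  define v where "v p = real (fst p) + Sup (?T p)" for p
  define P where "P = {p \<in> D \<times> D. ?T p \<noteq> {}}"
  have finP: "finite P"
    unfolding P_def by (simp add: finite_digits)
  have P: "\<exists>p\<in>P. real n * x - real (fst p) \<in> ?T p" if x: "x \<in> translate_inter n D t" for x
  proof -
    obtain d e where "d \<in> D" "e \<in> D"
      "real n * x - real d \<in> translate_inter n D (real n * t + real e - real d)"
      using translate_inter_unfold x by blast
    then show ?thesis
      by (intro bexI[of _ "(d, e)"]) (auto simp: P_def)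
  qed
  have "P \<noteq> {}"
    using assms P by blast
  then have "Max (v ` P) \<in> v ` P"
    using finP by (intro Max_in) auto
  then obtain p where p: "p \<in> P" and max: "Max (v ` P) = v p"
    by blast
  have max: "v p' \<le> v p" if "p' \<in> P" for p'
    using max finP that by (metis Max_ge finite_imageI imageI)
  have n0: "real n > 0"
    using n_ge by simp
  have "Sup (translate_inter n D t) \<le> v p / real n"
  proof (rule cSup_least[OF assms])
    fix x assume "x \<in> translate_inter n D t"
    then obtain p' where p': "p' \<in> P" "real n * x - real (fst p') \<in> ?T p'"
      using P by blast
    have "real n * x - real (fst p') \<le> Sup (?T p')"
      by (rule cSup_upper[OF p'(2) bdd_above_translate_inter])
    then have "real n * x \<le> v p"
      using max[OF p'(1)] by (simp add: v_def)
    then show "x \<le> v p / real n"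
      using n0 by (simp add: field_simps)
  qed
  then have le: "real n * Sup (translate_inter n D t) \<le> v p"
    using n0 by (simp add: field_simps)
  \<comment> \<open>Conversely, each point of the maximising copy scales back to a point of the
    original intersection.\<close>
  have "Sup (?T p) \<le> real n * Sup (translate_inter n D t) - real (fst p)"
  proof (rule cSup_least)
    show "?T p \<noteq> {}"
      using p by (simp add: P_def)
    fix y assume y: "y \<in> ?T p"
    have "(y + real (fst p)) / real n \<in> translate_inter n D t"
      using p y n0 by (subst translate_inter_unfold) (force simp: P_def)
    then have "(y + real (fst p)) / real n \<le> Sup (translate_inter n D t)"
      by (rule cSup_upper[OF _ bdd_above_translate_inter])
    then show "y \<le> real n * Sup (translate_inter n D t) - real (fst p)"
      using n0 by (simp add: field_simps)
  qed
  with le have "real n * Sup (translate_inter n D t) = real (fst p) + Sup (?T p)"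
    by (simp add: v_def)
  then show thesis
    using p that[of "snd p" "fst p"] by (simp add: P_def)
qed

section \<open>Rationality of the supremum for rational translations\<close>

lemma Sup_translate_inter_rational:
  assumes q: "q \<in> \<rat>" and ne: "translate_inter n D q \<noteq> {}"
  shows "Sup (translate_inter n D q) \<in> \<rat>"
proof -
  define F where "F t = Sup (translate_inter n D t)" for t
  obtain a b :: int where b: "b > 0" and q_eq: "q = of_int a / of_int b"
    using q by (metis Rats_cases')
  \<comment> \<open>Multiples of \<open>1 / b\<close> are preserved by \<open>t\<close> \<mapsto>
    \<open>n * t + e - d\<close>, and only finitely many of them lie in [-1, 1].\<close>
  define S where "S = {t. translate_inter n D t \<noteq> {} \<and> of_int b * t \<in> \<int>}"
  have "finite S"
  proof (rule finite_subset)
    show "S \<subseteq> (\<lambda>z. of_int z / of_int b) ` {- b..b}"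
    proof
      fix t assume t: "t \<in> S"
      then obtain z where z: "of_int b * t = of_int z"
        by (auto simp: S_def elim: Ints_cases)
      have "\<bar>t\<bar> \<le> 1"
        using t abs_translation_le_1 by (simp add: S_def)
      then have "\<bar>of_int b * t\<bar> \<le> of_int b"
        using b by (simp add: abs_mult)
      then have "z \<in> {- b..b}"
        unfolding z by (simp add: abs_le_iff)
      moreover have "t = of_int z / of_int b"
        using z b by (simp add: field_simps)
      ultimately show "t \<in> (\<lambda>z. of_int z / of_int b) ` {- b..b}"
        by blast
    qed
  qed simp
  have "\<exists>t'\<in>S. \<exists>d::nat. real n * F t = real d + F t'" if t: "t \<in> S" for t
  proof -
    have "translate_inter n D t \<noteq> {}"
      using t by (simp add: S_def)
    then obtain d e where de: "translate_inter n D (real n * t + real e - real d) \<noteq> {}"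
      "real n * F t = real d + F (real n * t + real e - real d)"
      unfolding F_def by (rule Sup_translate_inter_unfold)
    have "of_int b * (real n * t + real e - real d)
        = real n * (of_int b * t) + of_int b * real e - of_int b * real d"
      by (simp add: algebra_simps)
    also have "\<dots> \<in> \<int>"
      using t by (auto simp: S_def)
    finally show ?thesis
      using de by (auto simp: S_def)
  qed
  \<comment> \<open>Fixing one maximising digit pair for each translation gives a map
    \<open>g\<close> of \<open>S\<close> into itself, whose orbits can be followed.\<close>
  then obtain g d where g: "\<And>t. t \<in> S \<Longrightarrow> g t \<in> S"
    and d: "\<And>t. t \<in> S \<Longrightarrow> real n * F t = real (d t :: nat) + F (g t)"
    by metis
  have qS: "q \<in> S"
    using ne b by (simp add: S_def q_eq)
  have orbit: "(g ^^ k) t \<in> S" if "t \<in> S" for k t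
    by (induction k) (use that g in auto)
  have iter: "real n ^ k * F t - F ((g ^^ k) t) \<in> \<rat>" if t: "t \<in> S" for k t
  proof (induction k)
    case (Suc k)
    have "real n ^ Suc k * F t - F ((g ^^ Suc k) t)
        = real n * (real n ^ k * F t - F ((g ^^ k) t)) + real (d ((g ^^ k) t))"
      using d[OF orbit[OF t, of k]] by (simp add: algebra_simps)
    also have "\<dots> \<in> \<rat>"
      using Suc by (intro Rats_add Rats_mult) auto
    finally show ?case .
  qed simp
  \<comment> \<open>Pigeonhole: an orbit inside the finite set \<open>S\<close> must repeat.\<close>
  have "\<not> inj (\<lambda>k. (g ^^ k) q)"
    using \<open>finite S\<close> orbit[OF qS]
    by (metis finite_imageD finite_subset image_subsetI infinite_UNIV_nat)
  then have "\<exists>i j. i < j \<and> (g ^^ i) q = (g ^^ j) q"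
    unfolding inj_on_def by (metis nat_neq_iff)
  then obtain i j where "i < j" and ij: "(g ^^ i) q = (g ^^ j) q"
    by blast
  then obtain p where p: "p > 0" "j = p + i"
    using less_imp_add_positive by (metis add.commute)
  define t where "t = (g ^^ i) q"
  have period: "(g ^^ p) t = t"
    using ij p by (simp add: t_def funpow_add)
  have npow: "real n ^ p > 1"
    using n_ge p(1) by (intro one_less_power) auto
  \<comment> \<open>Around a cycle of length \<open>p\<close> the recursion returns to
    \<open>F t\<close>, which leaves a linear equation with the nonzero coefficient
    \<open>n ^ p - 1\<close>.\<close>
  have "real n ^ p * F t - F t \<in> \<rat>"
    using iter[OF orbit[OF qS, of i], of p] period by (simp add: t_def)
  then have "(real n ^ p * F t - F t) / (real n ^ p - 1) \<in> \<rat>"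
    by (rule Rats_divide) simp
  moreover have "(real n ^ p * F t - F t) / (real n ^ p - 1) = F t"
    using npow by (simp add: field_simps)
  ultimately have "F t \<in> \<rat>"
    by simp
  \<comment> \<open>The \<open>i\<close> steps leading from \<open>q\<close> into the cycle carry
    rationality back to \<open>F q\<close>.\<close>
  with iter[OF qS, of i] have "real n ^ i * F q - F t + F t \<in> \<rat>"
    unfolding t_def by (intro Rats_add)
  then have "(real n ^ i * F q - F t + F t) / real n ^ i \<in> \<rat>"
    by (intro Rats_divide Rats_power) auto
  then show ?thesis
    using n_ge by (simp add: F_def)
qed

text \<open>The supremum of the normalised set is the diameter of the intersection, the invariant
  that separates \<alpha> from the rationals.\<close>

lemma Sup_normalized_inter:
  assumes "translate_inter n D t \<noteq> {}"
  shows "Sup (normalized_inter n D t) = Sup (translate_inter n D t) - Inf (translate_inter n D t)"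
  using assms Sup_add_eq[of "\<lambda>x. x" "translate_inter n D t" "- Inf (translate_inter n D t)"]
    bdd_above_translate_inter[of t]
  by (simp add: normalized_inter_def)

end

section \<open>Reflection symmetry of uniform digit sets and of their Cantor sets\<close>

lemma uniform_digits_symmetric:
  assumes "finite D" and "Min D = 0" and "uniform_digits D" and "d \<in> D"
  shows "Max D - d \<in> D"
proof -
  let ?xs = "sorted_list_of_set D"
  obtain c where c: "c \<ge> 2"
    and step: "\<And>k. Suc k < card D \<Longrightarrow> int (?xs ! Suc k) - int (?xs ! k) = c"
    using assms(3) by (auto simp: uniform_digits_def)
  have len: "length ?xs = card D" and set: "set ?xs = D"
    using assms(1) by auto
  have "D \<noteq> {}"
    using assms(4) by auto
  then have "?xs ! 0 = 0"
    using sorted_list_of_set_nonempty[OF assms(1)] assms(2) by simp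
  \<comment> \<open>Equal gaps starting at 0 make the digits the multiples \<open>k * c\<close>.
    With \<open>Max D = l * c\<close>, reflection is \<open>k\<close> \<mapsto> \<open>l - k\<close>
    on indices.\<close>
  then have nth: "k < card D \<Longrightarrow> int (?xs ! k) = int k * c" for k
    by (induction k) (use step in \<open>force simp: algebra_simps\<close>)+
  have digits: "x \<in> D \<longleftrightarrow> (\<exists>k<card D. int x = int k * c)" for x
    by (metis in_set_conv_nth len nat_int nth set)
  obtain k where k: "k < card D" "int d = int k * c"
    using digits assms(4) by blast
  obtain l where l: "l < card D" "int (Max D) = int l * c"
    using digits Max_in[OF assms(1) \<open>D \<noteq> {}\<close>] by blast
  \<comment> \<open>Ensures that the natural-number subtraction \<open>Max D - d\<close> does not
    truncate.\<close>
  have le: "d \<le> Max D"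
    using assms by simp
  then have "int k * c \<le> int l * c"
    using k l by (metis of_nat_le_iff)
  then have "k \<le> l"
    using c by simp
  then have "int (Max D - d) = int (l - k) * c"
    using le k l by (simp add: of_nat_diff algebra_simps)
  moreover have "l - k < card D"
    using l by simp
  ultimately show ?thesis
    using digits by blast
qed

locale symmetric_cantor_digits = cantor_digits +
  assumes symmetric: "d \<in> D \<Longrightarrow> Max D - d \<in> D"
begin

text \<open>The largest point of the Cantor set: every digit equals \<open>Max D\<close>.\<close>

definition L :: real where "L = real (Max D) / (real n - 1)"

lemma L_rational: "L \<in> \<rat>"
  by (simp add: L_def)

text \<open>Subtract the expansion of \<open>r\<close> digit by digit from the constant expansion of
  \<open>L\<close>; by symmetry the differences are again digits.\<close>

lemma reflect_cantor_set:
  assumes "r \<in> cantor_set n D"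
  shows "L - r \<in> cantor_set n D"
proof -
  obtain x :: "nat \<Rightarrow> nat" where x: "\<And>k. x k \<in> D"
    and r: "r = (\<Sum>k. real (x k) / real n ^ Suc k)"
    using assms by (auto simp: mem_cantor_set_iff)
  have "(\<lambda>k. real (x k) / real n ^ Suc k) sums r"
    unfolding r by (intro summable_sums expansion_summable x)
  from sums_diff[OF constant_digit_sums[of "real (Max D)"] this]
  have "(\<lambda>k. real (Max D - x k) / real n ^ Suc k) sums (L - r)"
    using Max_ge[OF finite_digits x] by (simp add: L_def of_nat_diff diff_divide_distrib)
  then show ?thesis
    unfolding mem_cantor_set_iff using symmetric[OF x]
    by (intro exI[of _ "\<lambda>k. Max D - x k"]) (blast intro: sums_unique)
qed

text \<open>Since 0 and \<alpha> lie in the Cantor set, \<alpha> is the least point of the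
  intersection; reflecting 0 and \<alpha> shows that \<open>L\<close> is the greatest.\<close>

lemma Sup_normalized_inter_of_mem:
  assumes "\<alpha> \<in> cantor_set n D"
  shows "translate_inter n D \<alpha> \<noteq> {}" and "Sup (normalized_inter n D \<alpha>) = L - \<alpha>"
proof -
  have \<alpha>: "\<alpha> \<in> translate_inter n D \<alpha>"
    using assms zero_in_cantor_set by (simp add: mem_translate_inter)
  then show ne: "translate_inter n D \<alpha> \<noteq> {}"
    by blast
  have "Inf (translate_inter n D \<alpha>) = \<alpha>"
    using cantor_set_nonneg by (intro cInf_eq_minimum[OF \<alpha>]) (force simp: mem_translate_inter)
  moreover have "Sup (translate_inter n D \<alpha>) = L"
  proof (rule cSup_eq_maximum)
    show "L \<in> translate_inter n D \<alpha>"
      using reflect_cantor_set[OF assms] reflect_cantor_set[OF zero_in_cantor_set]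
      by (simp add: mem_translate_inter)
  qed (auto simp: mem_translate_inter L_def cantor_set_le_Max)
  ultimately show "Sup (normalized_inter n D \<alpha>) = L - \<alpha>"
    by (simp add: Sup_normalized_inter[OF ne])
qed

text \<open>Reflection exchanges the roles of the two points \<open>x\<close> and
  \<open>x - t\<close>.\<close>

lemma reflect_translate_inter:
  assumes "x \<in> translate_inter n D t"
  shows "L + t - x \<in> translate_inter n D t"
  using assms reflect_cantor_set[of x] reflect_cantor_set[of "x - t"]
  by (simp add: mem_translate_inter algebra_simps)

text \<open>The reflection swaps infimum and supremum, so rationality of the diameter needs only
  that of the supremum.\<close>

lemma Inf_translate_inter:
  assumes "translate_inter n D t \<noteq> {}"
  shows "Inf (translate_inter n D t) = L + t - Sup (translate_inter n D t)"
proof (rule antisym)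
  let ?T = "translate_inter n D t"
  have "Sup ?T \<le> L + t - Inf ?T"
  proof (rule cSup_least[OF assms])
    fix x assume "x \<in> ?T"
    from cInf_lower[OF reflect_translate_inter[OF this] bdd_below_translate_inter]
    show "x \<le> L + t - Inf ?T"
      by linarith
  qed
  then show "Inf ?T \<le> L + t - Sup ?T"
    by linarith
  show "L + t - Sup ?T \<le> Inf ?T"
  proof (rule cInf_greatest[OF assms])
    fix x assume "x \<in> ?T"
    from cSup_upper[OF reflect_translate_inter[OF this] bdd_above_translate_inter]
    show "L + t - Sup ?T \<le> x"
      by linarith
  qed
qed

lemma Sup_normalized_inter_rational:
  assumes "q \<in> \<rat>" and "translate_inter n D q \<noteq> {}"
  shows "Sup (normalized_inter n D q) \<in> \<rat>"
  unfolding Sup_normalized_inter[OF assms(2)] Inf_translate_inter[OF assms(2)]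
  by (intro Rats_diff Rats_add Sup_translate_inter_rational L_rational assms)

end

theorem mainTheorem6:
  fixes n :: nat and D :: "nat set" and \<alpha> :: real
  assumes "digit_set n D"
    and "uniform_digits D"
    and "\<alpha> \<in> cantor_set n D"
    and "\<alpha> \<notin> \<rat>"
  shows "\<forall>q\<in>\<rat>. \<not> translation_equivalent n D \<alpha> q"
proof (intro ballI notI)
  fix q :: real assume q: "q \<in> \<rat>" and eq: "translation_equivalent n D \<alpha> q"
  interpret cantor_digits n D
    by unfold_locales (rule assms(1))
  interpret symmetric_cantor_digits n D
    by unfold_locales
      (use uniform_digits_symmetric[OF finite_digits _ assms(2)] assms(1) in \<open>simp add: digit_set_def\<close>)
  have eq: "normalized_inter n D q = normalized_inter n D \<alpha>"
    using eq by (simp add: translation_equivalent_def)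
  \<comment> \<open>An empty intersection would normalise to the empty set, whereas the normalised
    set of \<alpha> is nonempty.\<close>
  then have "translate_inter n D q \<noteq> {}"
    using Sup_normalized_inter_of_mem(1)[OF assms(3)]
    by (auto simp: normalized_inter_def split: if_splits)
  then have "L - \<alpha> \<in> \<rat>"
    using Sup_normalized_inter_rational[OF q] Sup_normalized_inter_of_mem(2)[OF assms(3)] eq by simp
  from Rats_diff[OF L_rational this] have "\<alpha> \<in> \<rat>"
    by simp
  with assms(4) show False
    by simp
qed

end
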